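(* Let $f:\mathbb{R}^n\to\mathbb{R}$ be twice differentiable with $L_H$-Lipschitz Hessian, i.e. $\|\nabla^2 f(x)-\nabla^2 f(y)\|\le L_H\|x-y\|$ for all $x,y\in\mathbb{R}^n$ (some $L_H\ge 0$), and suppose $f^\star:=\inf f>-\infty$. Let $M>0$ with $M\ge L_H$, let $x_0\in\mathbb{R}^n$ with $\nabla f(x_0)\neq 0$, and let $x_{k+1}=x_k+s_k^\star$ for $k\ge 0$, where $s_k^\star$ is a global minimizer over $s\in\mathbb{R}^n$ of the cubic model $$m_k(s)=\langle \nabla f(x_k),s\rangle+\tfrac12\langle \nabla^2 f(x_k)s,s\rangle+\tfrac{M}{6}\|s\|^3 .$$ For $\varepsilon>0$ put $$K=\left\lceil \frac{12\,(f(x_0)-f^\star)}{M}\Bigl(\frac{L_H+M}{2}\Bigr)^{3/2}\varepsilon^{-3/2}\right\rceil .$$ Then for every $\varepsilon>0$ there is an index $i$ with $1\le i\le K$ such that both $$\|\nabla f(x_i)\|\le\varepsilon\qquad\text{and}\qquad \lambda_n\bigl(\nabla^2 f(x_i)\bigr)\ge-\frac{M+2L_H}{\sqrt{2(L_H+M)}}\,\sqrt{\varepsilon},$$ where $\lambda_n(\cdot)$ denotes the smallest eigenvalue. With the choice $M=2L_H$ (when $L_H>0$) the curvature threshold on the right equals $-\tfrac{4}{\sqrt6}\sqrt{L_H\varepsilon}$.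
   Context: Norms are the Euclidean norm for vectors and the induced operator (spectral) norm for matrices. *)

theory Defs
  imports "HOL-Analysis.Analysis"
begin

definition gradient :: "('a::euclidean_space \<Rightarrow> real) \<Rightarrow> 'a \<Rightarrow> 'a" where
  "gradient f x = (THE D. GDERIV f x :> D)"

lemma gradient_eqI:
  fixes f :: "'a::euclidean_space \<Rightarrow> real"
  assumes "GDERIV f x :> D"
  shows "gradient f x = D"
  unfolding gradient_def
proof (rule the_equality)
  fix D'
  assume "GDERIV f x :> D'"
  with assms have "(\<lambda>h. inner h D') = (\<lambda>h. inner h D)"
    unfolding gderiv_def by (rule has_derivative_unique[rotated])
  then show "D' = D"
    by (metis inner_commute vector_eq_rdot)
qed (rule assms)

lemma gradient_works:
  fixes f :: "'a::euclidean_space \<Rightarrow> real"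
  assumes "f differentiable (at x)"
  shows "GDERIV f x :> gradient f x"
proof -
  from assms obtain f' where f': "(f has_derivative f') (at x)"
    by (auto simp: differentiable_def)
  then have "linear f'"
    by (rule has_derivative_linear)
  then have "f' = (\<lambda>h. inner h (adjoint f' 1))"
    by (auto simp: adjoint_works)
  with f' have "GDERIV f x :> adjoint f' 1"
    unfolding gderiv_def by simp
  with gradient_eqI show ?thesis
    by metis
qed

definition twice_differentiable :: "('a::euclidean_space \<Rightarrow> real) \<Rightarrow> bool" where
  "twice_differentiable f \<longleftrightarrow>
     (\<forall>x. f differentiable (at x)) \<and> (\<forall>x. gradient f differentiable (at x))"

definition hessian :: "(real ^ 'n \<Rightarrow> real) \<Rightarrow> real ^ 'n \<Rightarrow> real ^ 'n ^ 'n" where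
  "hessian f x = jacobian (gradient f) (at x)"

text \<open>The norm that the type class assigns to \<^typ>\<open>real ^ 'n ^ 'n\<close> is the Frobenius norm,
  so the spectral norm is introduced separately.\<close>

definition spectral_norm :: "real ^ 'n ^ 'n \<Rightarrow> real" where
  "spectral_norm A = onorm (\<lambda>v. A *v v)"

definition eigenvalue_of :: "real ^ 'n ^ 'n \<Rightarrow> real \<Rightarrow> bool" where
  "eigenvalue_of A c \<longleftrightarrow> (\<exists>v. v \<noteq> 0 \<and> A *v v = c *s v)"

text \<open>Only real eigenvalues are considered; the value is meaningful for matrices that have one,
  in particular for symmetric matrices, whose eigenvalues are all real.\<close>

definition smallest_eigenvalue :: "real ^ 'n ^ 'n \<Rightarrow> real" where
  "smallest_eigenvalue A = (LEAST c. eigenvalue_of A c)"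

definition cubic_model :: "(real ^ 'n \<Rightarrow> real) \<Rightarrow> real \<Rightarrow> real ^ 'n \<Rightarrow> real ^ 'n \<Rightarrow> real" where
  "cubic_model f M x s =
     gradient f x \<bullet> s + 1 / 2 * ((hessian f x *v s) \<bullet> s) + M / 6 * norm s ^ 3"

end

theory Submission
  imports Defs
begin

text \<open>
  The reflection of the minimizer \<open>s\<close> in an arbitrary hyperplane has the same norm, so comparing
  the cubic model at the two points shows that \<open>H + (M/2) |s| I\<close> is positive semidefinite, beyond
  what second-order optimality gives. Together with stationarity and Taylor's formula, a step of
  length \<open>r\<close> then decreases \<open>f\<close> by at least \<open>M r\<^sup>3 / 12\<close> and leads to a point
  whose gradient is at most \<open>(L\<^sub>H + M) r\<^sup>2 / 2\<close> and whose Hessian is bounded below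
  by \<open>-(M/2 + L\<^sub>H) r\<close>. Hence a step with \<open>r\<^sup>2 \<le> 2 \<epsilon> / (L\<^sub>H + M)\<close>
  produces the desired point, and the total decrease available limits the number of longer steps.
\<close>

section \<open>Two facts from one-variable calculus\<close>

text \<open>For a small \<open>t\<close> of sign opposite to a nonzero \<open>a\<close>, the linear
  term would outweigh the quadratic one. This is the first-order condition used for the Rayleigh
  quotient, the symmetry of the Hessian and the cubic model.\<close>

lemma linear_coeff_eq_0_if_quadratic_nonneg:
  fixes a C :: real
  assumes "\<And>t. \<bar>t\<bar> \<le> 1 \<Longrightarrow> 0 \<le> a * t + C * t\<^sup>2"
  shows "a = 0"
proof (rule ccontr)
  assume "a \<noteq> 0"
  \<comment> \<open>\<open>K\<close> dominates \<open>C\<close> and is so large that the minimizer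
    \<open>- a / (2 * K)\<close> of \<open>a * t + K * t\<^sup>2\<close> stays in [-1, 1].\<close>
  define K where "K = \<bar>C\<bar> + \<bar>a\<bar> + 1"
  define t where "t = - a / (2 * K)"
  have K: "K > 0" "C \<le> K" "\<bar>a\<bar> \<le> 2 * K" by (auto simp: K_def)
  have "\<bar>t\<bar> \<le> 1" using K by (simp add: t_def abs_mult divide_le_eq)
  from assms[OF this] have "0 \<le> a * t + C * t\<^sup>2" .
  also have "\<dots> \<le> a * t + K * t\<^sup>2" using K by (intro add_left_mono mult_right_mono) auto
  also have "\<dots> = - a\<^sup>2 / (4 * K)" using K by (simp add: t_def field_simps power2_eq_square)
  also have "\<dots> < 0" using K \<open>a \<noteq> 0\<close> by (simp add: divide_neg_pos)
  finally show False by simp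
qed

text \<open>Subtracting the antiderivative of \<open>c * t ^ n\<close> leaves a function that does
  not increase on [0, 1]. The cases n = 1 and n = 2 give the Taylor remainders, n = 0 the second
  difference.\<close>

lemma increment_le_if_DERIV_le_power:
  fixes \<phi> \<phi>' :: "real \<Rightarrow> real"
  assumes D: "\<And>t. (\<phi> has_real_derivative \<phi>' t) (at t)"
    and le: "\<And>t. 0 \<le> t \<Longrightarrow> t \<le> 1 \<Longrightarrow> \<phi>' t \<le> c * t ^ n"
  shows "\<phi> 1 - \<phi> 0 \<le> c / (real n + 1)"
proof -
  let ?\<psi> = "\<lambda>t. \<phi> t - c / (real n + 1) * t ^ Suc n"
  have "?\<psi> 0 \<ge> ?\<psi> 1"
  proof (rule DERIV_nonpos_imp_nonincreasing[of 0 1 ?\<psi>])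
    fix t :: real assume t: "0 \<le> t" "t \<le> 1"
    have "(?\<psi> has_real_derivative (\<phi>' t - c / (real n + 1) * (real (Suc n) * t ^ n))) (at t)"
      by (rule derivative_eq_intros D refl | simp)+
    moreover have "c / (real n + 1) * (real (Suc n) * t ^ n) = c * t ^ n"
      by (simp add: field_simps)
    ultimately show "\<exists>y. (?\<psi> has_real_derivative y) (at t) \<and> y \<le> 0"
      using le[OF t] by auto
  qed simp
  then show ?thesis by simp
qed

section \<open>Smallest eigenvalue of a symmetric matrix\<close>

text \<open>Symmetry as a property of the bilinear form, which is how it emerges from second
  differences of \<open>f\<close>.\<close>

definition symmetric_form :: "real ^ 'n ^ 'n \<Rightarrow> bool" where
  "symmetric_form A \<longleftrightarrow> (\<forall>u v. u \<bullet> (A *v v) = v \<bullet> (A *v u))"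

lemma symmetric_form_expand:
  fixes A :: "real ^ 'n ^ 'n"
  assumes "symmetric_form A"
  shows "(u + t *\<^sub>R v) \<bullet> (A *v (u + t *\<^sub>R v))
    = u \<bullet> (A *v u) + 2 * t * (v \<bullet> (A *v u)) + t\<^sup>2 * (v \<bullet> (A *v v))"
proof -
  have "u \<bullet> (A *v v) = v \<bullet> (A *v u)" using assms by (simp add: symmetric_form_def)
  then show ?thesis
    by (simp add: matrix_vector_right_distrib matrix_vector_mult_scaleR inner_add_left
        inner_add_right power2_eq_square algebra_simps)
qed

text \<open>\<open>LEAST\<close> is meaningful only once a least eigenvalue is known to exist. The
  minimum of the quadratic form on the unit sphere is one: by compactness it is attained, the
  minimizer is an eigenvector, and every eigenvalue is the Rayleigh quotient of its
  eigenvector.\<close>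

lemma smallest_eigenvalue_is_eigenvalue:
  fixes A :: "real ^ 'n ^ 'n"
  assumes sym: "symmetric_form A"
  shows "eigenvalue_of A (smallest_eigenvalue A)"
proof -
  let ?q = "\<lambda>v. v \<bullet> (A *v v)"
  have "continuous_on (sphere 0 1) ?q"
    by (intro continuous_intros linear_continuous_on) auto
  moreover have "sphere (0::real^'n) 1 \<noteq> {}" by simp
  ultimately obtain v where v: "v \<in> sphere 0 1" and min: "\<And>w. w \<in> sphere 0 1 \<Longrightarrow> ?q v \<le> ?q w"
    using continuous_attains_inf[OF compact_sphere, of 0 1 ?q] by blast
  define c where "c = ?q v"
  have nv: "norm v = 1" "v \<bullet> v = 1" using v by (auto simp: norm_eq_1)
  have rayleigh: "c * (w \<bullet> w) \<le> ?q w" for w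
  proof (cases "w = 0")
    case False
    define y where "y = (1 / norm w) *\<^sub>R w"
    have w: "w = norm w *\<^sub>R y" using False by (simp add: y_def)
    have "norm y = 1" using False by (simp add: y_def)
    then have y: "c \<le> ?q y" by (simp add: c_def min)
    have "?q (norm w *\<^sub>R y) = (norm w)\<^sup>2 * ?q y"
      by (simp add: matrix_vector_mult_scaleR power2_eq_square)
    then have "?q w = (norm w)\<^sup>2 * ?q y" unfolding w[symmetric] .
    then show ?thesis
      using mult_left_mono[OF y, of "(norm w)\<^sup>2"]
      by (simp add: power2_norm_eq_inner mult.commute)
  qed simp
  have "A *v v = c *\<^sub>R v"
  proof -
    have "w \<bullet> (A *v v - c *\<^sub>R v) = 0" for w
    proof -
      \<comment> \<open>The Rayleigh bound at \<open>v + t *\<^sub>R w\<close> is a quadratic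
        inequality in \<open>t\<close> with equality at 0, so its linear coefficient
        vanishes.\<close>
      have "0 \<le> (2 * (w \<bullet> (A *v v - c *\<^sub>R v))) * t + (?q w - c * (w \<bullet> w)) * t\<^sup>2" for t
      proof -
        have "(v + t *\<^sub>R w) \<bullet> (v + t *\<^sub>R w) = 1 + 2 * t * (w \<bullet> v) + t\<^sup>2 * (w \<bullet> w)"
          by (simp add: inner_add_left inner_add_right nv power2_eq_square inner_commute
              algebra_simps)
        with rayleigh[of "v + t *\<^sub>R w"] have "c * (1 + 2 * t * (w \<bullet> v) + t\<^sup>2 * (w \<bullet> w))
          \<le> c + 2 * t * (w \<bullet> (A *v v)) + t\<^sup>2 * ?q w"
          unfolding symmetric_form_expand[OF sym] c_def by simp
        then show ?thesis by (simp add: inner_diff_right algebra_simps)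
      qed
      from linear_coeff_eq_0_if_quadratic_nonneg[OF this] show ?thesis by simp
    qed
    then show ?thesis by (metis inner_eq_zero_iff eq_iff_diff_eq_0)
  qed
  then have "eigenvalue_of A c"
    unfolding eigenvalue_of_def using nv(1)
    by (intro exI[of _ v]) (auto simp: scalar_mult_eq_scaleR)
  moreover have "c \<le> d" if "eigenvalue_of A d" for d
  proof -
    from that obtain w where w: "w \<noteq> 0" "A *v w = d *s w" by (auto simp: eigenvalue_of_def)
    then have "c * (w \<bullet> w) \<le> d * (w \<bullet> w)"
      using rayleigh[of w] by (simp add: scalar_mult_eq_scaleR)
    with w(1) show ?thesis by (simp add: mult_le_cancel_right)
  qed
  ultimately show ?thesis
    unfolding smallest_eigenvalue_def by (metis LeastI2_order)
qed

lemma smallest_eigenvalue_ge: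
  fixes A :: "real ^ 'n ^ 'n"
  assumes "symmetric_form A" and "\<And>v. c * (v \<bullet> v) \<le> v \<bullet> (A *v v)"
  shows "c \<le> smallest_eigenvalue A"
proof -
  from smallest_eigenvalue_is_eigenvalue[OF assms(1)]
  obtain w where w: "w \<noteq> 0" "A *v w = smallest_eigenvalue A *s w"
    by (auto simp: eigenvalue_of_def)
  then have "c * (w \<bullet> w) \<le> smallest_eigenvalue A * (w \<bullet> w)"
    using assms(2)[of w] by (simp add: scalar_mult_eq_scaleR)
  with w(1) show ?thesis by (simp add: mult_le_cancel_right)
qed

subsection \<open>Functions with Lipschitz Hessian\<close>

text \<open>The Lipschitz condition is stated vector by vector, which keeps the operator norm out of
  the estimates. With \<open>g\<close> and \<open>H\<close> as parameters, the locale can also be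
  instantiated at the negated function.\<close>

locale lipschitz_hessian =
  fixes f :: "real ^ 'n \<Rightarrow> real" and g :: "real ^ 'n \<Rightarrow> real ^ 'n"
    and H :: "real ^ 'n \<Rightarrow> real ^ 'n ^ 'n" and L :: real
  assumes f_deriv: "(f has_derivative (\<lambda>h. g x \<bullet> h)) (at x)"
    and g_deriv: "(g has_derivative (\<lambda>h. H x *v h)) (at x)"
    and L_nonneg: "0 \<le> L"
    and H_lipschitz: "norm ((H x - H y) *v v) \<le> L * norm (x - y) * norm v"
begin

lemma f_line: "((\<lambda>t. f (x + t *\<^sub>R h)) has_real_derivative (g (x + t *\<^sub>R h) \<bullet> h)) (at t)"
proof -
  have "((\<lambda>t. x + t *\<^sub>R h) has_derivative (\<lambda>t. t *\<^sub>R h)) (at t)"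
    by (auto intro!: derivative_eq_intros)
  from has_derivative_compose[OF this f_deriv] show ?thesis
    by (simp add: has_field_derivative_def mult.commute[of _ "g (x + t *\<^sub>R h) \<bullet> h"])
qed

lemma g_line:
  "((\<lambda>t. u \<bullet> g (x + t *\<^sub>R h)) has_real_derivative (u \<bullet> (H (x + t *\<^sub>R h) *v h))) (at t)"
proof -
  have "((\<lambda>t. x + t *\<^sub>R h) has_derivative (\<lambda>t. t *\<^sub>R h)) (at t)"
    by (auto intro!: derivative_eq_intros)
  from has_derivative_inner_right[OF has_derivative_compose[OF this g_deriv], of u] show ?thesis
    by (simp add: has_field_derivative_def matrix_vector_mult_scaleR mult_commute_abs)
qed

text \<open>The vector-valued remainder is made scalar by pairing it with itself and is then
  integrated along the segment from \<open>x\<close> to \<open>x + h\<close>.\<close>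

lemma gradient_taylor: "norm (g (x + h) - g x - H x *v h) \<le> L / 2 * (norm h)\<^sup>2"
proof -
  \<comment> \<open>With this \<open>u\<close>, the increment \<open>?\<phi> 1 - ?\<phi> 0\<close>
    is exactly \<open>u \<bullet> u\<close>; dividing by \<open>norm u\<close> finishes the
    proof.\<close>
  define u where "u = g (x + h) - g x - H x *v h"
  let ?\<phi> = "\<lambda>t. u \<bullet> g (x + t *\<^sub>R h) - t * (u \<bullet> (H x *v h))"
  have "?\<phi> 1 - ?\<phi> 0 \<le> (norm u * (L * (norm h)\<^sup>2)) / (real 1 + 1)"
  proof (rule increment_le_if_DERIV_le_power[of ?\<phi>])
    show "(?\<phi> has_real_derivative
        (u \<bullet> (H (x + t *\<^sub>R h) *v h) - u \<bullet> (H x *v h))) (at t)" for t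
      by (rule derivative_eq_intros g_line refl | simp)+
    fix t :: real assume t: "0 \<le> t" "t \<le> 1"
    have "u \<bullet> (H (x + t *\<^sub>R h) *v h) - u \<bullet> (H x *v h) = u \<bullet> ((H (x + t *\<^sub>R h) - H x) *v h)"
      by (simp add: matrix_vector_mult_diff_rdistrib inner_diff_right)
    also have "\<dots> \<le> norm u * norm ((H (x + t *\<^sub>R h) - H x) *v h)"
      by (rule norm_cauchy_schwarz)
    also have "\<dots> \<le> norm u * (L * norm (t *\<^sub>R h) * norm h)"
      using H_lipschitz[of "x + t *\<^sub>R h" x h] by (intro mult_left_mono) auto
    also have "\<dots> = norm u * (L * (norm h)\<^sup>2) * t ^ 1"
      using t by (simp add: power2_eq_square)
    finally show "u \<bullet> (H (x + t *\<^sub>R h) *v h) - u \<bullet> (H x *v h)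
      \<le> norm u * (L * (norm h)\<^sup>2) * t ^ 1" .
  qed
  then have "u \<bullet> u \<le> norm u * (L / 2 * (norm h)\<^sup>2)"
    by (simp add: u_def inner_diff_right)
  then have "norm u * norm u \<le> norm u * (L / 2 * (norm h)\<^sup>2)"
    by (simp add: power2_norm_eq_inner[symmetric] power2_eq_square)
  then have "norm u \<le> L / 2 * (norm h)\<^sup>2"
    using L_nonneg by (cases "u = 0") auto
  then show ?thesis by (simp add: u_def)
qed

text \<open>Integrates \<open>gradient_taylor\<close> along the segment: the remainder has
  derivative at most \<open>L / 2 * norm h ^ 3 * t\<^sup>2\<close>.\<close>

lemma function_taylor:
  "f (x + h) \<le> f x + g x \<bullet> h + 1 / 2 * (h \<bullet> (H x *v h)) + L / 6 * norm h ^ 3"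
proof -
  let ?\<phi> = "\<lambda>t. f (x + t *\<^sub>R h) - t * (g x \<bullet> h) - t\<^sup>2 / 2 * (h \<bullet> (H x *v h))"
  have "?\<phi> 1 - ?\<phi> 0 \<le> (L / 2 * norm h ^ 3) / (real 2 + 1)"
  proof (rule increment_le_if_DERIV_le_power[of ?\<phi>])
    show "(?\<phi> has_real_derivative (g (x + t *\<^sub>R h) \<bullet> h - g x \<bullet> h - t * (h \<bullet> (H x *v h)))) (at t)"
      for t
      by (rule derivative_eq_intros f_line refl | simp)+
    fix t :: real assume t: "0 \<le> t" "t \<le> 1"
    have "g (x + t *\<^sub>R h) \<bullet> h - g x \<bullet> h - t * (h \<bullet> (H x *v h))
      = (g (x + t *\<^sub>R h) - g x - H x *v (t *\<^sub>R h)) \<bullet> h"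
      by (simp add: inner_diff_left matrix_vector_mult_scaleR inner_commute[of h])
    also have "\<dots> \<le> norm (g (x + t *\<^sub>R h) - g x - H x *v (t *\<^sub>R h)) * norm h"
      by (rule norm_cauchy_schwarz)
    also have "\<dots> \<le> (L / 2 * (norm (t *\<^sub>R h))\<^sup>2) * norm h"
      by (intro mult_right_mono gradient_taylor) auto
    also have "\<dots> = (L / 2 * norm h ^ 3) * t ^ 2"
      by (simp add: power2_eq_square power3_eq_cube)
    finally show "g (x + t *\<^sub>R h) \<bullet> h - g x \<bullet> h - t * (h \<bullet> (H x *v h))
      \<le> (L / 2 * norm h ^ 3) * t ^ 2" .
  qed
  then show ?thesis by simp
qed

text \<open>Prepares the symmetry of the Hessian: the second difference of \<open>f\<close> is
  symmetric in \<open>u\<close> and \<open>v\<close>, and \<open>v \<bullet> (H x *v u)\<close>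
  matches it up to third order. The derivative in direction \<open>v\<close> is a difference of two
  gradient remainders, each at most \<open>L / 2 * (norm u + norm v)\<^sup>2\<close>.\<close>

lemma second_difference:
  "f (x + u + v) - f (x + u) - (f (x + v) - f x) - v \<bullet> (H x *v u) \<le> L * (norm u + norm v) ^ 3"
proof -
  let ?N = "norm u + norm v"
  let ?\<phi> = "\<lambda>t. f (x + u + t *\<^sub>R v) - f (x + t *\<^sub>R v) - t * (v \<bullet> (H x *v u))"
  have "?\<phi> 1 - ?\<phi> 0 \<le> (L * ?N ^ 3) / (real 0 + 1)"
  proof (rule increment_le_if_DERIV_le_power[of ?\<phi>])
    show "(?\<phi> has_real_derivative
        (g (x + u + t *\<^sub>R v) \<bullet> v - g (x + t *\<^sub>R v) \<bullet> v - v \<bullet> (H x *v u))) (at t)" for t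
      by (rule derivative_eq_intros f_line refl | simp)+
    fix t :: real assume t: "0 \<le> t" "t \<le> 1"
    let ?R = "\<lambda>h. g (x + h) - g x - H x *v h"
    have tv: "norm (t *\<^sub>R v) \<le> norm v" using t by (simp add: mult_left_le_one_le)
    have "norm (u + t *\<^sub>R v) \<le> ?N" using norm_triangle_ineq[of u "t *\<^sub>R v"] tv by linarith
    then have "L / 2 * (norm (u + t *\<^sub>R v))\<^sup>2 \<le> L / 2 * ?N\<^sup>2"
      using L_nonneg by (intro mult_left_mono power_mono) auto
    then have 1: "norm (?R (u + t *\<^sub>R v)) \<le> L / 2 * ?N\<^sup>2"
      using gradient_taylor[of x "u + t *\<^sub>R v"] by linarith
    have "norm (t *\<^sub>R v) \<le> ?N" using tv norm_ge_zero[of u] by linarith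
    then have "L / 2 * (norm (t *\<^sub>R v))\<^sup>2 \<le> L / 2 * ?N\<^sup>2"
      using L_nonneg by (intro mult_left_mono power_mono) auto
    then have 2: "norm (?R (t *\<^sub>R v)) \<le> L / 2 * ?N\<^sup>2"
      using gradient_taylor[of x "t *\<^sub>R v"] by linarith
    have "g (x + u + t *\<^sub>R v) \<bullet> v - g (x + t *\<^sub>R v) \<bullet> v - v \<bullet> (H x *v u)
      = (?R (u + t *\<^sub>R v) - ?R (t *\<^sub>R v)) \<bullet> v"
      by (simp add: inner_diff_left inner_commute matrix_vector_right_distrib
          inner_add_left algebra_simps)
    also have "\<dots> \<le> norm (?R (u + t *\<^sub>R v) - ?R (t *\<^sub>R v)) * norm v"
      by (rule norm_cauchy_schwarz)
    also have "\<dots> \<le> (L * ?N\<^sup>2) * ?N"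
      using norm_triangle_ineq4[of "?R (u + t *\<^sub>R v)" "?R (t *\<^sub>R v)"] 1 2 L_nonneg
      by (intro mult_mono) auto
    also have "\<dots> = L * ?N ^ 3 * t ^ 0" by (simp add: power2_eq_square power3_eq_cube)
    finally show "g (x + u + t *\<^sub>R v) \<bullet> v - g (x + t *\<^sub>R v) \<bullet> v - v \<bullet> (H x *v u)
      \<le> L * ?N ^ 3 * t ^ 0" .
  qed
  then show ?thesis by simp
qed

text \<open>The upper bound applied to the negated function, whose Hessian has the same Lipschitz
  constant.\<close>

lemma second_difference_lower:
  "- (L * (norm u + norm v) ^ 3) \<le> f (x + u + v) - f (x + u) - (f (x + v) - f x) - v \<bullet> (H x *v u)"
proof -
  interpret neg: lipschitz_hessian "\<lambda>x. - f x" "\<lambda>x. - g x" "\<lambda>x. - H x" L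
  proof
    have neg: "(- A) *v h = - (A *v h)" for A :: "real^'n^'n" and h
      using matrix_vector_mult_diff_rdistrib[of 0 A h] by simp
    show "((\<lambda>x. - f x) has_derivative (\<lambda>h. - g x \<bullet> h)) (at x)" for x
      using has_derivative_minus[OF f_deriv[of x]] by simp
    show "((\<lambda>x. - g x) has_derivative (\<lambda>h. - H x *v h)) (at x)" for x
      using has_derivative_minus[OF g_deriv[of x]] by (simp add: neg)
    show "0 \<le> L" by (rule L_nonneg)
    show "norm ((- H x - - H y) *v v) \<le> L * norm (x - y) * norm v" for x y v
      using H_lipschitz[of y x v] by (simp add: norm_minus_commute)
  qed
  have "(- H x) *v u = - (H x *v u)"
    using matrix_vector_mult_diff_rdistrib[of 0 "H x" u] by simp
  then show ?thesis using neg.second_difference[of x u v] by simp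
qed

text \<open>Both \<open>u \<bullet> (H x *v v)\<close> and \<open>v \<bullet> (H x *v u)\<close>
  approximate the same second difference. Scaling \<open>u\<close> and \<open>v\<close> by
  \<open>t\<close> multiplies their gap by \<open>t\<^sup>2\<close> but the error by
  \<open>\<bar>t\<bar> ^ 3\<close>, so the gap is zero.\<close>

lemma hessian_symmetric: "symmetric_form (H x)"
  unfolding symmetric_form_def
proof (intro allI)
  fix u v
  have bound: "\<bar>u \<bullet> (H x *v v) - v \<bullet> (H x *v u)\<bar> \<le> 2 * L * (norm u + norm v) ^ 3" for u v
    using second_difference[of x u v] second_difference[of x v u]
      second_difference_lower[of u v x] second_difference_lower[of v u x]
    by (simp add: ac_simps abs_le_iff)
  let ?a = "u \<bullet> (H x *v v) - v \<bullet> (H x *v u)"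
  let ?C = "2 * L * (norm u + norm v) ^ 3"
  have "0 \<le> ?a * t + ?C * t\<^sup>2" for t
  proof (cases "t = 0")
    case False
    have "t\<^sup>2 * \<bar>?a\<bar> = \<bar>(t *\<^sub>R u) \<bullet> (H x *v (t *\<^sub>R v)) - (t *\<^sub>R v) \<bullet> (H x *v (t *\<^sub>R u))\<bar>"
    proof -
      have "(t *\<^sub>R u) \<bullet> (H x *v (t *\<^sub>R v)) - (t *\<^sub>R v) \<bullet> (H x *v (t *\<^sub>R u)) = t\<^sup>2 * ?a"
        by (simp add: matrix_vector_mult_scaleR power2_eq_square algebra_simps)
      then show ?thesis by (simp add: abs_mult)
    qed
    also have "\<dots> \<le> 2 * L * (norm (t *\<^sub>R u) + norm (t *\<^sub>R v)) ^ 3" by (rule bound)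
    also have "\<dots> = t\<^sup>2 * (\<bar>t\<bar> * ?C)"
    proof -
      have "norm (t *\<^sub>R u) + norm (t *\<^sub>R v) = \<bar>t\<bar> * (norm u + norm v)"
        by (simp add: distrib_left)
      moreover have "\<bar>t\<bar> ^ 3 = t\<^sup>2 * \<bar>t\<bar>" by (simp add: power3_eq_cube power2_eq_square)
      ultimately show ?thesis by (simp add: power_mult_distrib)
    qed
    finally have "\<bar>?a\<bar> \<le> \<bar>t\<bar> * ?C" using False by simp
    \<comment> \<open>One more factor \<open>\<bar>t\<bar>\<close> turns the bound into the
      linear-plus-quadratic shape of the first-order condition.\<close>
    then have "\<bar>t\<bar> * \<bar>?a\<bar> \<le> \<bar>t\<bar> * (\<bar>t\<bar> * ?C)" by (intro mult_left_mono) auto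
    moreover have "\<bar>t\<bar> * (\<bar>t\<bar> * ?C) = ?C * \<bar>t\<bar>\<^sup>2"
      by (simp only: power2_eq_square ac_simps)
    moreover have "\<bar>?a * t\<bar> = \<bar>t\<bar> * \<bar>?a\<bar>" by (simp only: abs_mult ac_simps)
    ultimately have "\<bar>?a * t\<bar> \<le> ?C * t\<^sup>2" by simp
    then show ?thesis by linarith
  qed simp
  from linear_coeff_eq_0_if_quadratic_nonneg[OF this]
  show "u \<bullet> (H x *v v) = v \<bullet> (H x *v u)" by simp
qed

end

subsection \<open>Global minimizers of the cubic model\<close>

text \<open>With \<open>a = norm s\<close> and \<open>b = norm (s + d)\<close>, the identity
  \<open>b ^ 3 = a ^ 3 + 3 / 2 * a * (b\<^sup>2 - a\<^sup>2) + (b - a)\<^sup>2 * (b + a / 2)\<close>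
  is exact; \<open>b\<^sup>2 - a\<^sup>2\<close> is polynomial in \<open>d\<close>, and
  \<open>\<bar>b - a\<bar>\<close> is at most \<open>norm d\<close>. No derivative of the norm is
  taken, so \<open>s = 0\<close> is included.\<close>

lemma norm_cube_expansion:
  fixes s d :: "'a::real_inner"
  shows "norm (s + d) ^ 3
    \<le> norm s ^ 3 + 3 / 2 * norm s * (2 * (s \<bullet> d) + (norm d)\<^sup>2) + (norm d)\<^sup>2 * (norm (s + d) + norm s / 2)"
proof -
  let ?a = "norm s" and ?b = "norm (s + d)"
  have sq: "?b\<^sup>2 - ?a\<^sup>2 = 2 * (s \<bullet> d) + (norm d)\<^sup>2"
    by (simp add: power2_norm_eq_inner inner_add_left inner_add_right inner_commute)
  have "\<bar>?b - ?a\<bar> \<le> norm d" using norm_triangle_ineq3[of "s + d" s] by simp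
  then have le: "(?b - ?a)\<^sup>2 \<le> (norm d)\<^sup>2" by (metis abs_norm_cancel abs_le_square_iff)
  have "?b ^ 3 = ?a ^ 3 + 3 / 2 * ?a * (?b\<^sup>2 - ?a\<^sup>2) + (?b - ?a)\<^sup>2 * (?b + ?a / 2)"
    by (simp add: power2_eq_square power3_eq_cube field_simps)
  also have "\<dots> \<le> ?a ^ 3 + 3 / 2 * ?a * (?b\<^sup>2 - ?a\<^sup>2) + (norm d)\<^sup>2 * (?b + ?a / 2)"
    by (intro add_left_mono mult_right_mono le) auto
  finally show ?thesis by (simp only: sq)
qed

locale cubic_minimizer =
  fixes g :: "real ^ 'n" and A :: "real ^ 'n ^ 'n" and M :: real and s :: "real ^ 'n"
  assumes sym: "symmetric_form A" and M_pos: "0 < M"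
    and minimal: "g \<bullet> s + 1 / 2 * (s \<bullet> (A *v s)) + M / 6 * norm s ^ 3
      \<le> g \<bullet> w + 1 / 2 * (w \<bullet> (A *v w)) + M / 6 * norm w ^ 3"
begin

lemma stationary: "g + A *v s + (M / 2 * norm s) *\<^sub>R s = 0"
proof -
  have "(g + A *v s + (M / 2 * norm s) *\<^sub>R s) \<bullet> d = 0" for d
  proof -
    \<comment> \<open>Collects all terms of order \<open>t\<^sup>2\<close>; the last summand uses
      \<open>norm (s + t *\<^sub>R d) \<le> norm s + norm d\<close> for
      \<open>\<bar>t\<bar> \<le> 1\<close>.\<close>
    let ?C = "1 / 2 * (d \<bullet> (A *v d)) + M / 4 * norm s * (norm d)\<^sup>2
      + M / 6 * ((norm d)\<^sup>2 * (3 / 2 * norm s + norm d))"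
    have "0 \<le> (g + A *v s + (M / 2 * norm s) *\<^sub>R s) \<bullet> d * t + ?C * t\<^sup>2" if t: "\<bar>t\<bar> \<le> 1" for t
    proof -
      have "norm (s + t *\<^sub>R d) \<le> norm s + norm d"
        using norm_triangle_ineq[of s "t *\<^sub>R d"] t mult_left_le_one_le[of "norm d" "\<bar>t\<bar>"] by simp
      then have "(norm (t *\<^sub>R d))\<^sup>2 * (norm (s + t *\<^sub>R d) + norm s / 2)
        \<le> (norm (t *\<^sub>R d))\<^sup>2 * (3 / 2 * norm s + norm d)"
        by (intro mult_left_mono) auto
      then have "norm (s + t *\<^sub>R d) ^ 3 \<le> norm s ^ 3
          + 3 / 2 * norm s * (2 * (s \<bullet> (t *\<^sub>R d)) + (norm (t *\<^sub>R d))\<^sup>2)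
          + (norm (t *\<^sub>R d))\<^sup>2 * (3 / 2 * norm s + norm d)"
        using norm_cube_expansion[of s "t *\<^sub>R d"] by linarith
      then have cube: "M / 6 * norm (s + t *\<^sub>R d) ^ 3 \<le> M / 6 * (norm s ^ 3
          + 3 / 2 * norm s * (2 * (s \<bullet> (t *\<^sub>R d)) + (norm (t *\<^sub>R d))\<^sup>2)
          + (norm (t *\<^sub>R d))\<^sup>2 * (3 / 2 * norm s + norm d))"
        using M_pos by (intro mult_left_mono) auto
      have "0 \<le> t * (g \<bullet> d) + 1 / 2 * (2 * t * (d \<bullet> (A *v s)) + t\<^sup>2 * (d \<bullet> (A *v d)))
        + M / 6 * norm (s + t *\<^sub>R d) ^ 3 - M / 6 * norm s ^ 3"
        using minimal[of "s + t *\<^sub>R d"]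
        by (simp add: symmetric_form_expand[OF sym] inner_add_right add_divide_distrib)
      also have "\<dots> \<le> t * (g \<bullet> d) + 1 / 2 * (2 * t * (d \<bullet> (A *v s)) + t\<^sup>2 * (d \<bullet> (A *v d)))
        + M / 6 * (3 / 2 * norm s * (2 * (s \<bullet> (t *\<^sub>R d)) + (norm (t *\<^sub>R d))\<^sup>2)
          + (norm (t *\<^sub>R d))\<^sup>2 * (3 / 2 * norm s + norm d))"
        using cube by (simp add: distrib_left)
      also have "\<dots> = (g + A *v s + (M / 2 * norm s) *\<^sub>R s) \<bullet> d * t + ?C * t\<^sup>2"
        by (simp add: inner_add_left inner_commute[of d] power_mult_distrib)
           (simp add: field_simps power2_eq_square)
      finally show ?thesis .
    qed
    from linear_coeff_eq_0_if_quadratic_nonneg[OF this] show ?thesis .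
  qed
  then show ?thesis by (metis inner_eq_zero_iff)
qed

lemma gradient_inner: "g \<bullet> d = - (d \<bullet> (A *v s)) - M / 2 * norm s * (d \<bullet> s)"
proof -
  have "g = - (A *v s) - (M / 2 * norm s) *\<^sub>R s"
    using stationary by (simp add: eq_neg_iff_add_eq_0 algebra_simps)
  then show ?thesis
    by (simp add: inner_commute[of _ d] inner_diff_right)
qed

lemma curvature_nonorthogonal:
  assumes "d \<bullet> s \<noteq> 0"
  shows "0 \<le> d \<bullet> (A *v d) + M / 2 * norm s * (d \<bullet> d)"
proof -
  have d: "d \<bullet> d \<noteq> 0" using assms by auto
  \<comment> \<open>\<open>w\<close> is the reflection of \<open>s\<close> in the hyperplane
    orthogonal to \<open>d\<close>. It has the same norm, so the cubic terms cancel; eliminating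
    \<open>g\<close> by stationarity leaves the claim times \<open>c\<^sup>2 / 2\<close>, where
    \<open>c\<close> is nonzero as \<open>d\<close> is not orthogonal to \<open>s\<close>.\<close>
  define c where "c = 2 * (d \<bullet> s) / (d \<bullet> d)"
  define w where "w = s + (- c) *\<^sub>R d"
  have ds: "d \<bullet> s = c * (d \<bullet> d) / 2" using d by (simp add: c_def)
  have "c \<noteq> 0" using assms d by (simp add: c_def)
  have "w \<bullet> w = s \<bullet> s - 2 * c * (d \<bullet> s) + c * c * (d \<bullet> d)"
    by (simp add: w_def inner_diff_left inner_diff_right inner_commute algebra_simps)
  then have "norm w = norm s" by (simp add: norm_eq ds)
  then have "0 \<le> - c * (g \<bullet> d) + 1 / 2 * (- 2 * c * (d \<bullet> (A *v s)) + c\<^sup>2 * (d \<bullet> (A *v d)))"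
    using minimal[of w] symmetric_form_expand[OF sym, of s "- c" d]
    by (simp add: w_def inner_diff_right)
  also have "\<dots> = c\<^sup>2 / 2 * (d \<bullet> (A *v d) + M / 2 * norm s * (d \<bullet> d))"
    unfolding gradient_inner ds by (simp add: field_simps power2_eq_square)
  finally show ?thesis using \<open>c \<noteq> 0\<close> by (simp add: zero_le_mult_iff)
qed

lemma curvature: "- (M / 2 * norm s) * (d \<bullet> d) \<le> d \<bullet> (A *v d)"
proof (cases "s = 0")
  \<comment> \<open>No reflection is available at \<open>s = 0\<close>. There \<open>g\<close>
    vanishes, and the model along \<open>t *\<^sub>R d\<close>, divided by \<open>t\<^sup>2\<close>,
    gives the claim as \<open>t\<close> tends to 0 from the right.\<close>
  case True
  let ?b = "M / 6 * norm d ^ 3" and ?q = "d \<bullet> (A *v d)"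
  have g: "g \<bullet> w = 0" for w using gradient_inner[of w] True by simp
  have "0 \<le> t\<^sup>2 * (?q / 2 + t * ?b)" if "0 < t" for t
    using minimal[of "t *\<^sub>R d"] that unfolding True
    by (simp add: g matrix_vector_mult_scaleR power_mult_distrib power2_eq_square power3_eq_cube
        algebra_simps)
  then have "\<forall>\<^sub>F t in at_right 0. 0 \<le> ?q / 2 + t * ?b"
    by (auto simp: eventually_at_right_field zero_le_mult_iff intro!: exI[of _ 1])
  moreover have "((\<lambda>t. ?q / 2 + t * ?b) \<longlongrightarrow> ?q / 2 + 0 * ?b) (at_right 0)"
    by (intro tendsto_intros)
  ultimately have "0 \<le> ?q / 2 + 0 * ?b"
    by (intro tendsto_lowerbound) auto
  then show ?thesis using True by simp
next
  case s: False
  show ?thesis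
  proof (cases "d \<bullet> s = 0")
    \<comment> \<open>A direction orthogonal to \<open>s\<close> is a limit of the directions
      \<open>d + t *\<^sub>R s\<close>, which are not orthogonal to \<open>s\<close> for nonzero
      \<open>t\<close>.\<close>
    case True
    let ?q = "\<lambda>d. d \<bullet> (A *v d) + M / 2 * norm s * (d \<bullet> d)"
    have "0 \<le> ?q (d + t *\<^sub>R s)" if "t \<noteq> 0" for t
      by (rule curvature_nonorthogonal) (use s that True in \<open>simp add: inner_add_left\<close>)
    then have "\<forall>\<^sub>F t in at 0. 0 \<le> ?q (d + t *\<^sub>R s)"
      by (auto simp: eventually_at intro!: exI[of _ 1])
    moreover have "((\<lambda>t. ?q (d + t *\<^sub>R s)) \<longlongrightarrow> ?q (d + 0 *\<^sub>R s)) (at 0)"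
      by (intro tendsto_intros bounded_linear.tendsto[OF matrix_vector_mul_bounded_linear])
    ultimately have "0 \<le> ?q (d + 0 *\<^sub>R s)"
      by (intro tendsto_lowerbound) auto
    then show ?thesis by simp
  qed (use curvature_nonorthogonal in fastforce)
qed

text \<open>Stationarity turns the model value into
  \<open>- 1 / 2 * (s \<bullet> (A *v s)) - M / 3 * norm s ^ 3\<close>; by \<open>curvature\<close>
  the first term is at most \<open>M / 4 * norm s ^ 3\<close>, and 1/4 - 1/3 = -1/12.\<close>

lemma model_decrease: "g \<bullet> s + 1 / 2 * (s \<bullet> (A *v s)) + M / 6 * norm s ^ 3 \<le> - M / 12 * norm s ^ 3"
proof -
  have "norm s * (s \<bullet> s) = norm s ^ 3"
    by (simp add: power2_norm_eq_inner[symmetric] power2_eq_square power3_eq_cube)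
  then show ?thesis
    using gradient_inner[of s] curvature[of s] by (simp add: mult.assoc)
qed

end

section \<open>Effect of one cubic step\<close>

context lipschitz_hessian
begin

lemma step_estimates:
  assumes "cubic_minimizer (g x) (H x) M s" and "L \<le> M"
  shows "f (x + s) \<le> f x - M / 12 * norm s ^ 3"
    and "norm (g (x + s)) \<le> (L + M) / 2 * (norm s)\<^sup>2"
    and "- ((M / 2 + L) * norm s) \<le> smallest_eigenvalue (H (x + s))"
proof -
  interpret cubic_minimizer "g x" "H x" M s by fact
  \<comment> \<open>Since \<open>L \<le> M\<close>, the model plus \<open>f x\<close> bounds
    \<open>f (x + s)\<close> from above.\<close>
  have "L / 6 * norm s ^ 3 \<le> M / 6 * norm s ^ 3"
    using assms(2) by (intro mult_right_mono) auto
  then show "f (x + s) \<le> f x - M / 12 * norm s ^ 3"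
    using function_taylor[of x s] model_decrease by simp
  \<comment> \<open>Stationarity replaces the linearized gradient \<open>g x + H x *v s\<close> by
    \<open>- (M / 2 * norm s) *\<^sub>R s\<close>.\<close>
  have "g (x + s) = (g (x + s) - g x - H x *v s) - (M / 2 * norm s) *\<^sub>R s"
    using stationary by (simp add: algebra_simps eq_neg_iff_add_eq_0)
  then have "norm (g (x + s)) \<le> norm (g (x + s) - g x - H x *v s) + norm ((M / 2 * norm s) *\<^sub>R s)"
    by (metis norm_triangle_ineq4)
  also have "norm ((M / 2 * norm s) *\<^sub>R s) = M / 2 * (norm s)\<^sup>2"
    using M_pos by (simp add: power2_eq_square)
  finally show "norm (g (x + s)) \<le> (L + M) / 2 * (norm s)\<^sup>2"
    using gradient_taylor[of x s] by (simp add: add_divide_distrib distrib_right)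
  show "- ((M / 2 + L) * norm s) \<le> smallest_eigenvalue (H (x + s))"
  proof (rule smallest_eigenvalue_ge[OF hessian_symmetric])
    fix v
    \<comment> \<open>Moving from \<open>x\<close> to \<open>x + s\<close> costs at most
      \<open>L * norm s\<close> of curvature, on top of the bound \<open>- (M / 2 * norm s)\<close>
      at \<open>x\<close>.\<close>
    have "norm v * norm ((H (x + s) - H x) *v v) \<le> norm v * (L * norm s * norm v)"
      using H_lipschitz[of "x + s" x v] by (intro mult_left_mono) auto
    then have "norm v * norm ((H (x + s) - H x) *v v) \<le> L * norm s * (v \<bullet> v)"
      by (simp add: power2_norm_eq_inner[symmetric] power2_eq_square ac_simps)
    moreover have "\<bar>v \<bullet> ((H (x + s) - H x) *v v)\<bar> \<le> norm v * norm ((H (x + s) - H x) *v v)"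
      by (rule Cauchy_Schwarz_ineq2)
    ultimately have "- (L * norm s * (v \<bullet> v)) \<le> v \<bullet> ((H (x + s) - H x) *v v)"
      by linarith
    then show "- ((M / 2 + L) * norm s) * (v \<bullet> v) \<le> v \<bullet> (H (x + s) *v v)"
      using curvature[of v]
      by (simp add: matrix_vector_mult_diff_rdistrib inner_diff_right algebra_simps)
  qed
qed

end

subsection \<open>Complexity of the method\<close>

lemma lipschitz_hessian_gradient:
  fixes f :: "real ^ 'n \<Rightarrow> real"
  assumes "twice_differentiable f" and "0 \<le> L"
    and "\<forall>y z. spectral_norm (hessian f y - hessian f z) \<le> L * norm (y - z)"
  shows "lipschitz_hessian f (gradient f) (hessian f) L"
proof
  fix x y v :: "real ^ 'n"
  have "GDERIV f x :> gradient f x"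
    using assms(1) by (intro gradient_works) (simp add: twice_differentiable_def)
  then show "(f has_derivative (\<lambda>h. gradient f x \<bullet> h)) (at x)"
    by (simp add: gderiv_def inner_commute)
  show "(gradient f has_derivative (\<lambda>h. hessian f x *v h)) (at x)"
    using assms(1) unfolding hessian_def
    by (subst jacobian_works[symmetric]) (simp add: twice_differentiable_def)
  have "norm ((hessian f x - hessian f y) *v v)
    \<le> spectral_norm (hessian f x - hessian f y) * norm v"
    unfolding spectral_norm_def by (rule onorm) simp
  also have "\<dots> \<le> L * norm (x - y) * norm v"
    using assms(3) by (intro mult_right_mono) auto
  finally show "norm ((hessian f x - hessian f y) *v v) \<le> L * norm (x - y) * norm v" .
qed (rule assms(2))

text \<open>If the first \<open>N\<close> steps were all longer than \<open>R\<close>, they would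
  use up more than the available decrease \<open>F 0 - m\<close>. The index is \<open>Suc k\<close>
  because step \<open>k\<close> leads to iterate \<open>Suc k\<close>.\<close>

lemma exists_short_step:
  fixes F r :: "nat \<Rightarrow> real"
  assumes decrease: "\<And>k. F (Suc k) \<le> F k - M / 12 * r k ^ 3"
    and lower: "\<And>k. m \<le> F k" and pos: "m < F 0" and "0 < M" "0 < R"
  shows "\<exists>k. int (Suc k) \<le> \<lceil>12 * (F 0 - m) / (M * R ^ 3)\<rceil> \<and> r k \<le> R"
proof (rule ccontr)
  assume contra: "\<not> ?thesis"
  define q where "q = 12 * (F 0 - m) / (M * R ^ 3)"
  have "0 < q" using assms by (simp add: q_def)
  then have "0 < \<lceil>q\<rceil>" by simp
  define N where "N = nat \<lceil>q\<rceil>"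
  have N: "0 < N" "q \<le> real N" using \<open>0 < \<lceil>q\<rceil>\<close> by (auto simp: N_def)
  have long: "R < r k" if "k < N" for k
  proof -
    have "int (Suc k) \<le> \<lceil>q\<rceil>" using that by (simp add: N_def zless_nat_eq_int_zless)
    with contra show ?thesis unfolding q_def by force
  qed
  have cube: "M / 12 * R ^ 3 < M / 12 * r k ^ 3" if "k < N" for k
    using long[OF that] assms(4,5) by (simp add: power_strict_mono)
  \<comment> \<open>Strictness for positive \<open>n\<close> matters when \<open>q\<close> is an
    integer: \<open>real N \<le> q\<close> would not contradict \<open>q \<le> real N\<close>. It
    reaches \<open>n = N\<close> because \<open>N\<close> is positive.\<close>
  have "F n \<le> F 0 - real n * (M / 12 * R ^ 3) \<and> (0 < n \<longrightarrow> F n < F 0 - real n * (M / 12 * R ^ 3))"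
    if "n \<le> N" for n
    using that
  proof (induction n)
    case (Suc n)
    then have "F (Suc n) < F 0 - real n * (M / 12 * R ^ 3) - M / 12 * R ^ 3"
      using decrease[of n] cube[of n] by simp
    moreover have "real (Suc n) * (M / 12 * R ^ 3) = real n * (M / 12 * R ^ 3) + M / 12 * R ^ 3"
      by (simp add: distrib_right)
    ultimately show ?case by linarith
  qed simp
  then have "F N < F 0 - real N * (M / 12 * R ^ 3)" using N by simp
  with lower[of N] have "real N * (M / 12 * R ^ 3) < F 0 - m" by simp
  then have "real N < q" using assms(4,5) by (simp add: q_def field_simps)
  with N show False by simp
qed

theorem corollary3p11:
  fixes f :: "real ^ 'n \<Rightarrow> real"
    and L\<^sub>H M :: real
    and x s :: "nat \<Rightarrow> real ^ 'n"
  assumes "twice_differentiable f"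
    and "0 \<le> L\<^sub>H"
    and "\<forall>y z. spectral_norm (hessian f y - hessian f z) \<le> L\<^sub>H * norm (y - z)"
    and "bdd_below (range f)"
    and "0 < M" and "L\<^sub>H \<le> M"
    and "gradient f (x 0) \<noteq> 0"
    and "\<forall>k. is_arg_min (cubic_model f M (x k)) (\<lambda>_. True) (s k)"
    and "\<forall>k. x (Suc k) = x k + s k"
  shows "\<forall>\<epsilon>>0.
      (\<exists>i::nat. 1 \<le> i \<and>
         int i \<le> \<lceil>12 * (f (x 0) - (INF y. f y)) / M * ((L\<^sub>H + M) / 2) powr (3 / 2)
                   * \<epsilon> powr (- 3 / 2)\<rceil> \<and>
         norm (gradient f (x i)) \<le> \<epsilon> \<and>
         smallest_eigenvalue (hessian f (x i))
           \<ge> - ((M + 2 * L\<^sub>H) / sqrt (2 * (L\<^sub>H + M))) * sqrt \<epsilon>) \<and>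
      (0 < L\<^sub>H \<and> M = 2 * L\<^sub>H \<longrightarrow>
         - ((M + 2 * L\<^sub>H) / sqrt (2 * (L\<^sub>H + M))) * sqrt \<epsilon>
           = - (4 / sqrt 6) * sqrt (L\<^sub>H * \<epsilon>))"
proof -
  interpret lipschitz_hessian f "gradient f" "hessian f" L\<^sub>H
    by (rule lipschitz_hessian_gradient) (use assms in auto)
  have cubic: "cubic_minimizer (gradient f (x k)) (hessian f (x k)) M (s k)" for k
  proof
    show "gradient f (x k) \<bullet> s k + 1 / 2 * (s k \<bullet> (hessian f (x k) *v s k)) + M / 6 * norm (s k) ^ 3
      \<le> gradient f (x k) \<bullet> w + 1 / 2 * (w \<bullet> (hessian f (x k) *v w)) + M / 6 * norm w ^ 3" for w
      using assms(8) by (auto simp: is_arg_min_def cubic_model_def not_less inner_commute)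
  qed (use assms(5) hessian_symmetric in auto)
  have step: "f (x (Suc k)) \<le> f (x k) - M / 12 * norm (s k) ^ 3"
    "norm (gradient f (x (Suc k))) \<le> (L\<^sub>H + M) / 2 * (norm (s k))\<^sup>2"
    "- ((M / 2 + L\<^sub>H) * norm (s k)) \<le> smallest_eigenvalue (hessian f (x (Suc k)))" for k
    using step_estimates[OF cubic assms(6)] assms(9) by simp_all
  define m where "m = (INF y. f y)"
  have lower: "m \<le> f y" for y
    unfolding m_def by (rule cINF_lower[OF assms(4)]) simp
  \<comment> \<open>Otherwise \<open>x 0\<close> would be a global minimizer with nonzero gradient.
    Strict positivity of the gap makes the ceiling at least 1.\<close>
  have pos: "m < f (x 0)"
  proof (rule ccontr)
    assume "\<not> m < f (x 0)"
    then have "f (x 0) \<le> f y" for y using lower[of y] by simp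
    then have "(\<lambda>h. gradient f (x 0) \<bullet> h) = (\<lambda>h. 0)"
      by (intro differential_zero_maxmin[OF _ open_UNIV f_deriv]) auto
    then have "gradient f (x 0) \<bullet> gradient f (x 0) = 0" by meson
    with assms(7) show False by simp
  qed
  let ?P = "(L\<^sub>H + M) / 2"
  have P: "0 < ?P" using assms by simp
  have "\<exists>i::nat. 1 \<le> i \<and> int i \<le> \<lceil>12 * (f (x 0) - m) / M * ?P powr (3 / 2) * \<epsilon> powr (- 3 / 2)\<rceil> \<and>
      norm (gradient f (x i)) \<le> \<epsilon> \<and>
      smallest_eigenvalue (hessian f (x i)) \<ge> - ((M + 2 * L\<^sub>H) / sqrt (2 * (L\<^sub>H + M))) * sqrt \<epsilon>"
    if \<epsilon>: "0 < \<epsilon>" for \<epsilon>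
  proof -
    \<comment> \<open>Chosen so that \<open>?P * R\<^sup>2 = \<epsilon>\<close>: a step of length at
      most \<open>R\<close> brings the gradient norm down to \<open>\<epsilon>\<close>.\<close>
    define R where "R = sqrt (\<epsilon> / ?P)"
    have R: "0 < R" "R\<^sup>2 = \<epsilon> / ?P" using \<epsilon> P by (auto simp: R_def)
    have "R ^ 3 = (\<epsilon> / ?P) powr (3 / 2)"
    proof -
      have "R = (\<epsilon> / ?P) powr (1 / 2)" using \<epsilon> P by (simp add: R_def powr_half_sqrt)
      then have "R ^ 3 = ((\<epsilon> / ?P) powr (1 / 2)) powr 3" using \<epsilon> P R(1) by (simp add: powr_numeral)
      then show ?thesis by (simp add: powr_powr)
    qed
    also have "\<dots> = \<epsilon> powr (3 / 2) / ?P powr (3 / 2)"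
      by (rule powr_divide)
    \<comment> \<open>The step count for this \<open>R\<close> is exactly the quantity under the
      ceiling.\<close>
    finally have "12 * (f (x 0) - m) / (M * R ^ 3)
      = 12 * (f (x 0) - m) / M * ?P powr (3 / 2) * \<epsilon> powr (- 3 / 2)"
      using powr_minus_divide[of \<epsilon> "3 / 2"] by (simp add: field_simps)
    with exists_short_step[of "\<lambda>k. f (x k)" M "\<lambda>k. norm (s k)" m R] step(1) lower pos assms(5) R(1)
    obtain k where k: "int (Suc k) \<le> \<lceil>12 * (f (x 0) - m) / M * ?P powr (3 / 2) * \<epsilon> powr (- 3 / 2)\<rceil>"
      "norm (s k) \<le> R" by auto
    have "?P * (norm (s k))\<^sup>2 \<le> ?P * R\<^sup>2"
      using k(2) P by (intro mult_left_mono power_mono) auto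
    also have "\<dots> = \<epsilon>" using P R(2) by simp
    finally have grad: "norm (gradient f (x (Suc k))) \<le> \<epsilon>" using step(2)[of k] by simp
    \<comment> \<open>The fraction is extended so that \<open>(M / 2 + L\<^sub>H) * R\<close> takes
      the form of the stated curvature threshold.\<close>
    have R_eq: "R = 2 * sqrt \<epsilon> / sqrt (2 * (L\<^sub>H + M))"
    proof -
      have "\<epsilon> / ?P = 4 * \<epsilon> / (2 * (L\<^sub>H + M))" using P by (simp add: field_simps)
      then show ?thesis by (simp add: R_def real_sqrt_divide real_sqrt_mult)
    qed
    have "(M / 2 + L\<^sub>H) * norm (s k) \<le> (M / 2 + L\<^sub>H) * R"
      using k(2) assms by (intro mult_left_mono) auto
    also have "\<dots> = (M + 2 * L\<^sub>H) / sqrt (2 * (L\<^sub>H + M)) * sqrt \<epsilon>"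
      unfolding R_eq by (simp add: add_divide_distrib distrib_left distrib_right)
    finally have "smallest_eigenvalue (hessian f (x (Suc k)))
      \<ge> - ((M + 2 * L\<^sub>H) / sqrt (2 * (L\<^sub>H + M))) * sqrt \<epsilon>"
      using step(3)[of k] by simp
    with k(1) grad show ?thesis by (intro exI[of _ "Suc k"]) simp
  qed
  moreover have "- ((M + 2 * L\<^sub>H) / sqrt (2 * (L\<^sub>H + M))) * sqrt \<epsilon> = - (4 / sqrt 6) * sqrt (L\<^sub>H * \<epsilon>)"
    if "0 < L\<^sub>H" "M = 2 * L\<^sub>H" for \<epsilon>
  proof -
    \<comment> \<open>Here the numerator is \<open>4 * L\<^sub>H\<close> and the radicand is
      \<open>6 * L\<^sub>H\<close>.\<close>
    have "(M + 2 * L\<^sub>H) / sqrt (2 * (L\<^sub>H + M)) = 4 / sqrt 6 * (L\<^sub>H / sqrt L\<^sub>H)"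
      using that by (simp add: real_sqrt_mult)
    also have "L\<^sub>H / sqrt L\<^sub>H = sqrt L\<^sub>H" using that by (simp add: real_div_sqrt)
    finally show ?thesis by (simp add: real_sqrt_mult)
  qed
  ultimately show ?thesis unfolding m_def by blast
qed

end
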